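(* Consider the pile game with boundary with target $n\ge 1$ and a finite set of choices $R\subset\mathbb{Z}$ with given transition probabilities, played by two or more players. For any initial numbers of chips, the winning and the losing probability generating functions are rational functions of $x$. Hence, if the transition probabilities of all elements of $R$ are rational numbers, then the winning and losing probabilities (the values of these generating functions at $x=1$) are rational numbers.
   Context: Pile game with boundary for $M\ge2$ players: fix an integer $n\ge1$ and a finite set of integers $R=\{r_1,\dots,r_m\}$ (not necessarily positive), where $r_i$ is assigned probability $p(r_i)\ge0$ with $\sum_i p(r_i)=1$. Player $j$ starts with $s_j$ chips, $0\le s_j<n$. The players take turns cyclically in the order $1,2,\dots,M,1,2,\dots$. At his turn a player chooses, independently of everything else, $r_i\in R$ with probability $p(r_i)$ and replaces his number of chips $c$ by $\max(0,c+r_i)$. The game ends as soon as some player has $n$ chips or more, and that player wins. The winning probability generating function of a player is $\sum_{k\ge0}w(k)x^k$, where $w(k)$ is the probability that this player wins the game at his own $k$-th turn. The losing probability generating function of a player is $\sum_{k\ge0}l(k)x^k$, where $l(k)$ is the probability that the game is won by another player at that other player's $k$-th turn. The winning (losing) probability is $\sum_k w(k)$ (respectively $\sum_k l(k)$). *)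

theory Defs
  imports "HOL-Probability.Probability" "HOL-Computational_Algebra.Computational_Algebra"
begin

text \<open>
  Players are numbered \<open>1, \<dots>, M\<close>.  Turns are numbered \<open>0, 1, 2, \<dots>\<close> in the order of play (all
  players together), and a sample point \<open>\<omega>\<close> assigns to turn \<open>t\<close> the element \<open>\<omega> t\<close> of \<open>R\<close> that is
  chosen there.  The choices are independent and identically distributed.
\<close>

definition pile_space :: "int set \<Rightarrow> (int \<Rightarrow> real) \<Rightarrow> (nat \<Rightarrow> int) measure" where
  "pile_space R p = (\<Pi>\<^sub>M t\<in>(UNIV :: nat set). point_measure R (\<lambda>r. ennreal (p r)))"

definition mover :: "nat \<Rightarrow> nat \<Rightarrow> nat" where
  "mover M t = t mod M + 1"

text \<open>
  \<open>chips M s \<omega> t i\<close> is the number of chips of player \<open>i\<close> after the first \<open>t\<close> turns.  It is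
  convenient to let the process run on forever; what happens after some player has reached the
  target is ignored in \<open>wins_at\<close> below.
\<close>

primrec chips :: "nat \<Rightarrow> (nat \<Rightarrow> int) \<Rightarrow> (nat \<Rightarrow> int) \<Rightarrow> nat \<Rightarrow> nat \<Rightarrow> int" where
  "chips M s \<omega> 0 = s"
| "chips M s \<omega> (Suc t) =
     (chips M s \<omega> t)(mover M t := max 0 (chips M s \<omega> t (mover M t) + \<omega> t))"

text \<open>
  The \<open>k\<close>-th turn of player \<open>j\<close> (\<open>k \<ge> 1\<close>) is turn \<open>own_turn M j k\<close> of the game.
\<close>

definition own_turn :: "nat \<Rightarrow> nat \<Rightarrow> nat \<Rightarrow> nat" where
  "own_turn M j k = (k - 1) * M + (j - 1)"

lemma own_turn_iff:
  assumes "1 \<le> j" "j \<le> M"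
  shows "mover M t = j \<longleftrightarrow> (\<exists>k\<ge>1. t = own_turn M j k)"
proof
  assume "mover M t = j"
  then have "t mod M = j - 1"
    by (simp add: mover_def)
  then have "t = own_turn M j (t div M + 1)"
    using div_mult_mod_eq[of t M] by (simp add: own_turn_def)
  then show "\<exists>k\<ge>1. t = own_turn M j k"
    by (intro exI[of _ "t div M + 1"]) auto
next
  assume "\<exists>k\<ge>1. t = own_turn M j k"
  then show "mover M t = j"
  proof (elim exE conjE)
    fix k assume "t = own_turn M j k"
    then have "t mod M = (j - 1) mod M"
      by (simp add: own_turn_def)
    also have "\<dots> = j - 1"
      using assms by simp
    finally show ?thesis
      using assms by (simp add: mover_def)
  qed
qed

text \<open>
  Player \<open>j\<close> wins the game at his own \<open>k\<close>-th turn: before that turn nobody has ever had \<open>n\<close> or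
  more chips, and after it player \<open>j\<close> has.
\<close>

definition wins_at ::
  "nat \<Rightarrow> nat \<Rightarrow> (nat \<Rightarrow> int) \<Rightarrow> (nat \<Rightarrow> int) \<Rightarrow> nat \<Rightarrow> nat \<Rightarrow> bool" where
  "wins_at M n s \<omega> j k \<longleftrightarrow>
     k \<ge> 1 \<and>
     (\<forall>u \<le> own_turn M j k. \<forall>i\<in>{1..M}. chips M s \<omega> u i < int n) \<and>
     chips M s \<omega> (Suc (own_turn M j k)) j \<ge> int n"

definition win_prob_at ::
  "int set \<Rightarrow> (int \<Rightarrow> real) \<Rightarrow> nat \<Rightarrow> nat \<Rightarrow> (nat \<Rightarrow> int) \<Rightarrow> nat \<Rightarrow> nat \<Rightarrow> real" where
  "win_prob_at R p M n s j k =
     measure (pile_space R p) {\<omega> \<in> space (pile_space R p). wins_at M n s \<omega> j k}"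

definition lose_prob_at ::
  "int set \<Rightarrow> (int \<Rightarrow> real) \<Rightarrow> nat \<Rightarrow> nat \<Rightarrow> (nat \<Rightarrow> int) \<Rightarrow> nat \<Rightarrow> nat \<Rightarrow> real" where
  "lose_prob_at R p M n s j k =
     measure (pile_space R p)
       {\<omega> \<in> space (pile_space R p). \<exists>i\<in>{1..M} - {j}. wins_at M n s \<omega> i k}"

definition win_pgf ::
  "int set \<Rightarrow> (int \<Rightarrow> real) \<Rightarrow> nat \<Rightarrow> nat \<Rightarrow> (nat \<Rightarrow> int) \<Rightarrow> nat \<Rightarrow> real fps" where
  "win_pgf R p M n s j = Abs_fps (win_prob_at R p M n s j)"

definition lose_pgf ::
  "int set \<Rightarrow> (int \<Rightarrow> real) \<Rightarrow> nat \<Rightarrow> nat \<Rightarrow> (nat \<Rightarrow> int) \<Rightarrow> nat \<Rightarrow> real fps" where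
  "lose_pgf R p M n s j = Abs_fps (lose_prob_at R p M n s j)"

definition win_prob ::
  "int set \<Rightarrow> (int \<Rightarrow> real) \<Rightarrow> nat \<Rightarrow> nat \<Rightarrow> (nat \<Rightarrow> int) \<Rightarrow> nat \<Rightarrow> real" where
  "win_prob R p M n s j = (\<Sum>k. win_prob_at R p M n s j k)"

definition lose_prob ::
  "int set \<Rightarrow> (int \<Rightarrow> real) \<Rightarrow> nat \<Rightarrow> nat \<Rightarrow> (nat \<Rightarrow> int) \<Rightarrow> nat \<Rightarrow> real" where
  "lose_prob R p M n s j = (\<Sum>k. lose_prob_at R p M n s j k)"

text \<open>
  \<open>f\<close> is the expansion of a rational function \<open>a / b\<close>.  The equation is multiplied out because
  \<open>b\<close> may vanish at \<open>0\<close> and then is not a unit in the ring of power series.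
\<close>

definition rational_fps :: "real fps \<Rightarrow> bool" where
  "rational_fps f \<longleftrightarrow> (\<exists>a b :: real poly. b \<noteq> 0 \<and> f * fps_of_poly b = fps_of_poly a)"

text \<open>
  Sanity facts: the space is a probability space, all events used are measurable, and the
  winning and losing probabilities are sums of convergent series.  By \<open>pgf_at_1\<close> they are the
  values of the generating functions at \<open>1\<close>.
\<close>

lemma prob_space_pile_space:
  assumes "finite R" "\<And>r. r \<in> R \<Longrightarrow> p r \<ge> 0" "(\<Sum>r\<in>R. p r) = 1"
  shows "prob_space (pile_space R p)"
  unfolding pile_space_def
proof (rule prob_space_PiM)
  show "prob_space (point_measure R (\<lambda>r. ennreal (p r)))"
    using assms by (intro prob_spaceI)
      (simp add: space_point_measure emeasure_point_measure_finite sum_ennreal)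
qed

lemma measurable_chips:
  "(\<lambda>\<omega>. chips M s \<omega> t i) \<in> measurable (pile_space R p) (count_space UNIV)"
proof (induction t arbitrary: i)
  case 0
  then show ?case by simp
next
  case (Suc t)
  have "(\<lambda>\<omega>. \<omega> t) \<in> measurable (pile_space R p) (point_measure R (\<lambda>r. ennreal (p r)))"
    unfolding pile_space_def by measurable
  moreover have "(\<lambda>r. r) \<in> measurable (point_measure R (\<lambda>r. ennreal (p r))) (count_space UNIV)"
    by (auto simp: measurable_def space_point_measure sets_point_measure)
  ultimately have choice: "(\<lambda>\<omega>. \<omega> t) \<in> measurable (pile_space R p) (count_space UNIV)"
    by (rule measurable_compose)
  have IH: "\<And>i. (\<lambda>\<omega>. chips M s \<omega> t i) \<in> measurable (pile_space R p) (count_space UNIV)"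
    by (rule Suc.IH)
  have "(\<lambda>\<omega>. max 0 (c + \<omega> t)) \<in> measurable (pile_space R p) (count_space UNIV)" for c
    using measurable_compose[OF choice, of "\<lambda>r. max 0 (c + r)"] by simp
  then have "(\<lambda>\<omega>. max 0 (chips M s \<omega> t (mover M t) + \<omega> t))
               \<in> measurable (pile_space R p) (count_space UNIV)"
    by (rule measurable_compose_countable[OF _ IH])
  then show ?case
    using IH by (cases "i = mover M t") auto
qed

lemma wins_at_sets:
  "{\<omega> \<in> space (pile_space R p). wins_at M n s \<omega> j k} \<in> sets (pile_space R p)"
  unfolding wins_at_def using measurable_chips[measurable] by measurable

lemma wins_at_unique:
  assumes "wins_at M n s \<omega> i k" "wins_at M n s \<omega> i' k'" "i \<in> {1..M}" "i' \<in> {1..M}"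
  shows "i = i' \<and> k = k'"
proof -
  have "\<not> own_turn M i k < own_turn M i' k'"
    using assms unfolding wins_at_def by (meson Suc_leI linorder_not_le)
  moreover have "\<not> own_turn M i' k' < own_turn M i k"
    using assms unfolding wins_at_def by (meson Suc_leI linorder_not_le)
  ultimately have eq: "own_turn M i k = own_turn M i' k'"
    by simp
  have k: "k \<ge> 1" "k' \<ge> 1"
    using assms by (auto simp: wins_at_def)
  have ii: "i = i'"
    using own_turn_iff[of i M "own_turn M i k"] own_turn_iff[of i' M "own_turn M i k"]
      assms k eq by auto
  then have "(k - 1) * M = (k' - 1) * M"
    using eq by (simp add: own_turn_def)
  then show ?thesis
    using ii k assms by auto
qed

lemma win_prob_sums:
  assumes "finite R" "\<And>r. r \<in> R \<Longrightarrow> p r \<ge> 0" "(\<Sum>r\<in>R. p r) = 1" "j \<in> {1..M}"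
  shows "win_prob_at R p M n s j sums
    measure (pile_space R p) (\<Union>k. {\<omega> \<in> space (pile_space R p). wins_at M n s \<omega> j k})"
proof -
  interpret prob_space "pile_space R p"
    using assms by (intro prob_space_pile_space)
  show ?thesis
    unfolding win_prob_at_def
    using wins_at_sets assms(4) wins_at_unique
    by (intro finite_measure_UNION) (auto simp: disjoint_family_on_def)
qed

lemma lose_prob_sums:
  assumes "finite R" "\<And>r. r \<in> R \<Longrightarrow> p r \<ge> 0" "(\<Sum>r\<in>R. p r) = 1"
  shows "lose_prob_at R p M n s j sums
    measure (pile_space R p)
      (\<Union>k. {\<omega> \<in> space (pile_space R p). \<exists>i\<in>{1..M} - {j}. wins_at M n s \<omega> i k})"
proof -
  interpret prob_space "pile_space R p"
    using assms by (intro prob_space_pile_space)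
  have "{\<omega> \<in> space (pile_space R p). \<exists>i\<in>{1..M} - {j}. wins_at M n s \<omega> i k}
          \<in> sets (pile_space R p)" for k
    using wins_at_sets by (intro sets.sets_Collect_finite_Ex) auto
  moreover have "disjoint_family
      (\<lambda>k. {\<omega> \<in> space (pile_space R p). \<exists>i\<in>{1..M} - {j}. wins_at M n s \<omega> i k})"
    unfolding disjoint_family_on_def using wins_at_unique by blast
  ultimately show ?thesis
    unfolding lose_prob_at_def by (intro finite_measure_UNION image_subsetI)
qed

lemma pgf_at_1:
  "eval_fps (win_pgf R p M n s j) 1 = win_prob R p M n s j"
  "eval_fps (lose_pgf R p M n s j) 1 = lose_prob R p M n s j"
  by (simp_all add: eval_fps_def win_pgf_def lose_pgf_def win_prob_def lose_prob_def)

end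

theory Submission
  imports Defs
begin

text \<open>
  Condition on one turn at a time.  For a state \<open>s\<close> and \<open>i \<le> M\<close> let \<open>F i s\<close> be the generating
  function of a player's win when the game is entered with chips \<open>s\<close> just before turn \<open>i\<close> of a
  round.  Then \<open>F i s\<close> is a constant plus a convex combination of the \<open>F (i + 1) s'\<close>, and
  \<open>F M s = X * F 0 s\<close> since a round has been completed.  Unrolling a round yields a finite linear
  system \<open>F 0 = c + X Q (F 0)\<close>, which is solved by eliminating one state after another: each pivot
  \<open>1 - X q\<close> is a unit.  If the transition probabilities are rational, the solution is \<open>a / b\<close> with
  rational polynomials; since the series converges at \<open>1\<close>, a zero of \<open>b\<close> there is a zero of \<open>a\<close>,
  so factors \<open>1 - X\<close> can be cancelled until \<open>b\<close> does not vanish at \<open>1\<close>.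
\<close>

section \<open>Rational power series over a subring of the reals\<close>

text \<open>The parameter \<open>K\<close> lets one argument serve both claims: \<open>UNIV\<close>
  gives \<open>rational_fps\<close>, and \<rat> gives the arithmetic control needed for the values
  at 1.\<close>

definition rational_fps_over :: "real set \<Rightarrow> real fps \<Rightarrow> bool" where
  "rational_fps_over K f \<longleftrightarrow>
     (\<exists>a b. (\<forall>i. coeff a i \<in> K) \<and> (\<forall>i. coeff b i \<in> K) \<and> b \<noteq> 0 \<and>
       f * fps_of_poly b = fps_of_poly a)"

lemma rational_fps_over_UNIV: "rational_fps_over UNIV = rational_fps"
  by (simp add: rational_fps_over_def rational_fps_def fun_eq_iff)

locale real_subring =
  fixes K :: "real set"
  assumes one_mem: "1 \<in> K"
    and add_mem: "x \<in> K \<Longrightarrow> y \<in> K \<Longrightarrow> x + y \<in> K"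
    and mult_mem: "x \<in> K \<Longrightarrow> y \<in> K \<Longrightarrow> x * y \<in> K"
    and uminus_mem: "x \<in> K \<Longrightarrow> - x \<in> K"
begin

lemma zero_mem: "0 \<in> K"
  using add_mem[OF one_mem uminus_mem[OF one_mem]] by simp

lemma sum_mem: "(\<And>i. i \<in> A \<Longrightarrow> f i \<in> K) \<Longrightarrow> sum f A \<in> K"
  by (induction A rule: infinite_finite_induct) (auto intro: zero_mem add_mem)

lemma coeff_mult_mem:
  "(\<And>i. coeff a i \<in> K) \<Longrightarrow> (\<And>i. coeff b i \<in> K) \<Longrightarrow> coeff (a * b) i \<in> K"
  by (auto simp: coeff_mult intro: sum_mem mult_mem)

lemma rational_fps_over_polyI:
  assumes "\<And>i. coeff a i \<in> K" "\<And>i. coeff b i \<in> K" "b \<noteq> 0"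
    and "f * fps_of_poly b = fps_of_poly a"
  shows "rational_fps_over K f"
  using assms by (auto simp: rational_fps_over_def)

lemma rational_fps_over_const: "c \<in> K \<Longrightarrow> rational_fps_over K (fps_const c)"
  by (rule rational_fps_over_polyI[of "[:c:]" 1])
    (auto simp: coeff_pCons fps_of_poly_const zero_mem one_mem split: nat.split)

lemma rational_fps_over_0: "rational_fps_over K 0"
  using rational_fps_over_const[OF zero_mem] by simp

lemma rational_fps_over_1: "rational_fps_over K 1"
  using rational_fps_over_const[OF one_mem] by simp

lemma rational_fps_over_X: "rational_fps_over K fps_X"
  by (rule rational_fps_over_polyI[of "[:0, 1:]" 1])
    (auto simp: coeff_pCons fps_of_poly_pCons zero_mem one_mem split: nat.split)

lemma rational_fps_over_add:
  assumes "rational_fps_over K f" "rational_fps_over K g"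
  shows "rational_fps_over K (f + g)"
proof -
  obtain a b where ab: "\<And>i. coeff a i \<in> K" "\<And>i. coeff b i \<in> K" "b \<noteq> 0"
      "f * fps_of_poly b = fps_of_poly a"
    using assms(1) by (auto simp: rational_fps_over_def)
  obtain c d where cd: "\<And>i. coeff c i \<in> K" "\<And>i. coeff d i \<in> K" "d \<noteq> 0"
      "g * fps_of_poly d = fps_of_poly c"
    using assms(2) by (auto simp: rational_fps_over_def)
  show ?thesis
  proof (rule rational_fps_over_polyI)
    show "(f + g) * fps_of_poly (b * d) = fps_of_poly (a * d + b * c)"
      by (simp add: fps_of_poly_mult fps_of_poly_add flip: ab(4) cd(4)) (simp add: algebra_simps)
  qed (use ab cd in \<open>auto intro!: coeff_mult_mem add_mem\<close>)
qed

lemma rational_fps_over_mult: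
  assumes "rational_fps_over K f" "rational_fps_over K g"
  shows "rational_fps_over K (f * g)"
proof -
  obtain a b where ab: "\<And>i. coeff a i \<in> K" "\<And>i. coeff b i \<in> K" "b \<noteq> 0"
      "f * fps_of_poly b = fps_of_poly a"
    using assms(1) by (auto simp: rational_fps_over_def)
  obtain c d where cd: "\<And>i. coeff c i \<in> K" "\<And>i. coeff d i \<in> K" "d \<noteq> 0"
      "g * fps_of_poly d = fps_of_poly c"
    using assms(2) by (auto simp: rational_fps_over_def)
  show ?thesis
  proof (rule rational_fps_over_polyI)
    show "(f * g) * fps_of_poly (b * d) = fps_of_poly (a * c)"
      by (simp add: fps_of_poly_mult flip: ab(4) cd(4))
  qed (use ab cd in \<open>auto intro!: coeff_mult_mem\<close>)
qed

lemma rational_fps_over_sum: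
  "(\<And>i. i \<in> A \<Longrightarrow> rational_fps_over K (f i)) \<Longrightarrow> rational_fps_over K (sum f A)"
  by (induction A rule: infinite_finite_induct)
    (auto intro: rational_fps_over_0 rational_fps_over_add)

text \<open>If f = a / b then 1 / (1 - X f) = b / (b - X a), so no division in \<open>K\<close>
  occurs. The new denominator is nonzero because 1 - X f is a unit.\<close>

lemma rational_fps_over_inverse:
  assumes "rational_fps_over K f"
  shows "rational_fps_over K (inverse (1 - fps_X * f))"
proof -
  obtain a b where ab: "\<And>i. coeff a i \<in> K" "\<And>i. coeff b i \<in> K" "b \<noteq> 0"
      "f * fps_of_poly b = fps_of_poly a"
    using assms by (auto simp: rational_fps_over_def)
  have "(1 - fps_X * f) $ 0 \<noteq> 0"
    by simp
  then have unit: "inverse (1 - fps_X * f) * (1 - fps_X * f) = 1"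
    by (rule inverse_mult_eq_1)
  have den: "fps_of_poly (b - pCons 0 a) = (1 - fps_X * f) * fps_of_poly b"
    by (simp add: fps_of_poly_diff fps_of_poly_pCons algebra_simps flip: ab(4))
  show ?thesis
  proof (rule rational_fps_over_polyI)
    have "inverse (1 - fps_X * f) * fps_of_poly (b - pCons 0 a)
        = (inverse (1 - fps_X * f) * (1 - fps_X * f)) * fps_of_poly b"
      by (simp only: den mult.assoc)
    then show "inverse (1 - fps_X * f) * fps_of_poly (b - pCons 0 a) = fps_of_poly b"
      by (simp only: unit mult_1_left)
    show "b - pCons 0 a \<noteq> 0"
    proof
      assume "b - pCons 0 a = 0"
      then have "(1 - fps_X * f) * fps_of_poly b = 0"
        by (simp only: den[symmetric] fps_of_poly_0)
      then show False
        using unit ab(3) by auto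
    qed
    show "coeff (b - pCons 0 a) i \<in> K" for i
      using ab add_mem uminus_mem zero_mem
      by (auto simp: coeff_pCons diff_conv_add_uminus simp del: add_uminus_conv_diff
          split: nat.split)
  qed (use ab in auto)
qed

text \<open>Gaussian elimination by induction on \<open>S\<close>: the equation of \<open>x\<close>
  is solved for \<open>F x\<close> and substituted into the others. \<open>F\<close> stays fixed
  while \<open>c\<close> and \<open>q\<close> change; the factor X in front of the sum survives the
  substitution, so every later pivot again has constant term 1.\<close>

lemma rational_fps_over_linear_system:
  assumes "finite S"
    and "\<And>s. s \<in> S \<Longrightarrow> rational_fps_over K (c s)"
    and "\<And>s s'. s \<in> S \<Longrightarrow> s' \<in> S \<Longrightarrow> rational_fps_over K (q s s')"
    and "\<And>s. s \<in> S \<Longrightarrow> F s = c s + fps_X * (\<Sum>s'\<in>S. q s s' * F s')"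
    and "s \<in> S"
  shows "rational_fps_over K (F s)"
  using assms
proof (induction S arbitrary: c q s rule: finite_induct)
  case empty
  then show ?case by simp
next
  case (insert x S)
  note closed = rational_fps_over_add rational_fps_over_mult rational_fps_over_X
    rational_fps_over_inverse rational_fps_over_sum
  define u where "u = inverse (1 - fps_X * q x x)"
  have u: "rational_fps_over K u"
    unfolding u_def using insert.prems(2) by (intro closed) auto
  have "(1 - fps_X * q x x) $ 0 \<noteq> 0"
    by simp
  then have unit: "u * (1 - fps_X * q x x) = 1"
    unfolding u_def by (rule inverse_mult_eq_1)
  have "F x = c x + fps_X * (q x x * F x + (\<Sum>s'\<in>S. q x s' * F s'))"
    using insert.prems(3)[of x] insert.hyps by simp
  then have "(1 - fps_X * q x x) * F x = c x + fps_X * (\<Sum>s'\<in>S. q x s' * F s')"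
    by (simp add: algebra_simps)
  then have "u * (1 - fps_X * q x x) * F x = u * (c x + fps_X * (\<Sum>s'\<in>S. q x s' * F s'))"
    by (simp only: mult.assoc)
  then have Fx: "F x = u * (c x + fps_X * (\<Sum>s'\<in>S. q x s' * F s'))"
    by (simp only: unit mult_1_left)
  have FS: "rational_fps_over K (F s)" if "s \<in> S" for s
  proof (rule insert.IH)
    fix t assume t: "t \<in> S"
    have "F t = c t + fps_X * (q t x * F x + (\<Sum>s'\<in>S. q t s' * F s'))"
      using insert.prems(3)[of t] insert.hyps t by simp
    \<comment> \<open>These are the entries of the Schur complement of the pivot.\<close>
    also have "\<dots> = (c t + fps_X * (q t x * (u * c x)))
        + fps_X * (\<Sum>s'\<in>S. (q t s' + fps_X * (q t x * (u * q x s'))) * F s')"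
      by (subst Fx) (simp add: algebra_simps sum.distrib sum_distrib_left)
    finally show "F t = (c t + fps_X * (q t x * (u * c x)))
        + fps_X * (\<Sum>s'\<in>S. (q t s' + fps_X * (q t x * (u * q x s'))) * F s')" .
  qed (use insert.prems u that in \<open>auto intro!: closed\<close>)
  show ?case
  proof (cases "s = x")
    case True
    show ?thesis
      unfolding True Fx using insert.prems u FS by (intro closed) auto
  next
    case False
    then show ?thesis
      using FS insert.prems by auto
  qed
qed

section \<open>Values of rational power series at 1\<close>

text \<open>Dividing by 1 - X replaces coefficients by their partial sums, so nothing outside
  \<open>K\<close> arises.\<close>

lemma coeff_quotient_mem:
  assumes "\<And>i. coeff ([:1, -1:] * c) i \<in> K"
  shows "coeff c i \<in> K"
proof (induction i)
  case 0
  then show ?case using assms[of 0] by simp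
next
  case (Suc i)
  have "coeff c (Suc i) = coeff ([:1, -1:] * c) (Suc i) + coeff c i"
    by simp
  then show ?case
    using Suc assms add_mem by metis
qed

end

interpretation real_subring_UNIV: real_subring UNIV
  by unfold_locales auto

interpretation real_subring_Rats: real_subring \<rat>
  by unfold_locales auto

text \<open>Cauchy product of an absolutely convergent series with a finite one: the product
  equation may be evaluated at 1, even where \<open>b\<close> vanishes.\<close>

lemma fps_mult_poly_sums:
  fixes f :: "real fps"
  assumes "summable (\<lambda>k. norm (f $ k))" and "f * fps_of_poly b = fps_of_poly a"
  shows "(\<Sum>k. f $ k) * poly b 1 = poly a 1"
proof -
  have fin: "(\<lambda>k. coeff c k) sums poly c 1" for c :: "real poly"
  proof -
    have "(\<lambda>k. coeff c k) sums (\<Sum>k\<in>{..degree c}. coeff c k)"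
      by (rule sums_finite) (auto simp: coeff_eq_0)
    then show ?thesis
      by (simp add: poly_altdef)
  qed
  have "summable (\<lambda>k. norm (coeff b k))"
    by (rule summable_finite[of "{..degree b}"]) (auto simp: coeff_eq_0)
  then have "(\<Sum>k. f $ k) * (\<Sum>k. coeff b k) = (\<Sum>k. \<Sum>i\<le>k. f $ i * coeff b (k - i))"
    by (intro Cauchy_product assms(1))
  also have "(\<lambda>k. \<Sum>i\<le>k. f $ i * coeff b (k - i)) = (\<lambda>k. (f * fps_of_poly b) $ k)"
    by (simp add: fps_mult_nth atLeast0AtMost)
  also have "\<dots> = coeff a"
    by (simp add: assms(2) fun_eq_iff)
  finally show ?thesis
    using fin[of a] fin[of b] by (simp add: sums_iff)
qed

lemma rational_fps_over_Rats_suminf: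
  assumes "rational_fps_over \<rat> f" and summable: "summable (\<lambda>k. norm (f $ k))"
  shows "(\<Sum>k. f $ k) \<in> \<rat>"
proof -
  have "(\<Sum>k. f $ k) \<in> \<rat>"
    if "\<And>i. coeff a i \<in> \<rat>" "\<And>i. coeff b i \<in> \<rat>" "b \<noteq> 0"
      "f * fps_of_poly b = fps_of_poly a" for a b
    using that
  proof (induction "degree b" arbitrary: a b rule: less_induct)
    case less
    have eq: "(\<Sum>k. f $ k) * poly b 1 = poly a 1"
      by (rule fps_mult_poly_sums) (use summable less.prems in auto)
    have rat: "poly c 1 \<in> \<rat>" if "\<And>i. coeff c i \<in> \<rat>" for c :: "real poly"
      unfolding poly_altdef using that by (intro real_subring_Rats.sum_mem) simp
    show ?case
    proof (cases "poly b 1 = 0")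
      case False
      then have "(\<Sum>k. f $ k) = poly a 1 / poly b 1"
        using eq by (simp add: field_simps)
      then show ?thesis
        using rat less.prems by (simp add: Rats_divide)
    next
      case True
      \<comment> \<open>The factor is normalised to constant term 1 instead of leading coefficient
        1, to match \<open>coeff_quotient_mem\<close>.\<close>
      have div: "\<exists>d. c = [:1, -1:] * d" if "poly c 1 = 0" for c :: "real poly"
      proof -
        have "[:-1, 1:] dvd c"
          using that by (simp add: poly_eq_0_iff_dvd)
        then obtain d where "c = [:-1, 1:] * d" ..
        then have "c = [:1, -1:] * (- d)"
          by simp
        then show ?thesis ..
      qed
      obtain b' where b': "b = [:1, -1:] * b'"
        using div True by blast
      \<comment> \<open>By \<open>eq\<close>, the zero of \<open>b\<close> at 1 forces a zero of
        \<open>a\<close>; this is where convergence enters.\<close>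
      obtain a' where a': "a = [:1, -1:] * a'"
        using div True eq by force
      have "b' \<noteq> 0"
        using b' less.prems by auto
      then have "degree b = degree [:1, -1 :: real:] + degree b'"
        unfolding b' by (intro degree_mult_eq) auto
      then have "degree b' < degree b"
        by simp
      moreover have "fps_of_poly [:1, -1:] * (f * fps_of_poly b')
          = fps_of_poly [:1, -1:] * fps_of_poly a'"
        using less.prems(4) unfolding a' b' by (simp only: fps_of_poly_mult mult_ac)
      then have "f * fps_of_poly b' = fps_of_poly a'"
        by (subst (asm) mult_left_cancel) auto
      ultimately show ?thesis
        using less.hyps[of b' a'] \<open>b' \<noteq> 0\<close> less.prems(1,2) unfolding a' b'
        using real_subring_Rats.coeff_quotient_mem by blast
    qed
  qed
  then show ?thesis
    using assms(1) by (auto simp: rational_fps_over_def)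
qed

section \<open>Conditioning on the first turn\<close>

text \<open>Splitting off coordinate 0 identifies the sequence space with the product of one choice
  and a sequence (\<open>PiM_iter\<close>), and Fubini averages over the choice. The event
  \<open>B\<close> may depend on that choice, because the state entered next does.\<close>

lemma first_choice:
  assumes "finite R" "\<And>r. r \<in> R \<Longrightarrow> p r \<ge> 0" "(\<Sum>r\<in>R. p r) = 1"
    and B: "\<And>r. r \<in> R \<Longrightarrow> B r \<in> sets (pile_space R p)"
  shows "{\<omega> \<in> space (pile_space R p). (\<lambda>u. \<omega> (Suc u)) \<in> B (\<omega> 0)} \<in> sets (pile_space R p)"
    (is "?A \<in> _")
    and "measure (pile_space R p)
        {\<omega> \<in> space (pile_space R p). (\<lambda>u. \<omega> (Suc u)) \<in> B (\<omega> 0)}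
      = (\<Sum>r\<in>R. p r * measure (pile_space R p) (B r))"
proof -
  define N where "N = point_measure R (\<lambda>r. ennreal (p r))"
  have S: "pile_space R p = PiM UNIV (\<lambda>_. N)"
    by (simp add: pile_space_def N_def)
  have spN: "space N = R"
    by (simp add: N_def space_point_measure)
  interpret N: prob_space N
    using assms unfolding N_def by (intro prob_spaceI)
      (simp add: space_point_measure emeasure_point_measure_finite sum_ennreal)
  interpret sequence_space N
    by unfold_locales
  have shift: "(\<lambda>\<omega> u. \<omega> (Suc u)) \<in> measurable S S"
    by (rule measurable_PiM_single') (auto simp: space_PiM PiE_iff)
  have first: "{\<omega> \<in> space S. \<omega> 0 = r} \<in> sets S" if "r \<in> R" for r
  proof -
    have "(\<lambda>\<omega>. \<omega> 0) -` {r} \<inter> space S \<in> sets S"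
      using that by (intro measurable_sets[OF measurable_component_singleton])
        (auto simp: N_def sets_point_measure)
    moreover have "(\<lambda>\<omega>. \<omega> 0) -` {r} \<inter> space S = {\<omega> \<in> space S. \<omega> 0 = r}"
      by auto
    ultimately show ?thesis
      by metis
  qed
  \<comment> \<open>Measurability comes from splitting by the finitely many values of the first
    choice.\<close>
  have "?A = (\<Union>r\<in>R. {\<omega> \<in> space S. \<omega> 0 = r} \<inter> ((\<lambda>\<omega> u. \<omega> (Suc u)) -` B r \<inter> space S))"
    using spN by (auto simp: S space_PiM PiE_iff)
  also have "\<dots> \<in> sets S"
  proof (rule sets.finite_UN[OF \<open>finite R\<close>])
    fix r assume "r \<in> R"
    then show "{\<omega> \<in> space S. \<omega> 0 = r} \<inter> ((\<lambda>\<omega> u. \<omega> (Suc u)) -` B r \<inter> space S) \<in> sets S"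
      by (intro sets.Int first measurable_sets[OF shift] B[unfolded S])
  qed
  finally show A: "?A \<in> sets (pile_space R p)"
    by (simp add: S)
  \<comment> \<open>Cutting down to the product space loses nothing, because \<open>B r\<close> lies
    inside the sequence space.\<close>
  have slice: "Pair r -` ((\<lambda>(r, \<omega>). case_nat r \<omega>) -` ?A \<inter> space (N \<Otimes>\<^sub>M S)) = B r" if "r \<in> R" for r
    using that spN sets.sets_into_space[OF B[OF that]]
    by (auto simp: S space_PiM PiE_iff space_pair_measure split: nat.split)
  have cn: "(\<lambda>(r, \<omega>). case_nat r \<omega>) \<in> measurable (N \<Otimes>\<^sub>M S) S"
    by measurable
  have "emeasure S ?A = emeasure (distr (N \<Otimes>\<^sub>M S) S (\<lambda>(r, \<omega>). case_nat r \<omega>)) ?A"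
    by (simp add: PiM_iter)
  also have "\<dots> = emeasure (N \<Otimes>\<^sub>M S) ((\<lambda>(r, \<omega>). case_nat r \<omega>) -` ?A \<inter> space (N \<Otimes>\<^sub>M S))"
    using A by (intro emeasure_distr cn) (simp add: S)
  also have "\<dots> = (\<integral>\<^sup>+r. emeasure S
      (Pair r -` ((\<lambda>(r, \<omega>). case_nat r \<omega>) -` ?A \<inter> space (N \<Otimes>\<^sub>M S))) \<partial>N)"
    using A by (intro P.emeasure_pair_measure_alt measurable_sets[OF cn]) (simp add: S)
  also have "\<dots> = (\<integral>\<^sup>+r. emeasure S (B r) \<partial>N)"
    using slice spN by (intro nn_integral_cong) simp
  also have "\<dots> = (\<Sum>r\<in>R. ennreal (p r) * emeasure S (B r))"
    by (subst N_def) (simp add: nn_integral_point_measure_finite \<open>finite R\<close>)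
  also have "\<dots> = (\<Sum>r\<in>R. ennreal (p r * measure S (B r)))"
    using assms(2) by (intro sum.cong) (auto simp: P.emeasure_eq_measure ennreal_mult')
  also have "\<dots> = ennreal (\<Sum>r\<in>R. p r * measure S (B r))"
    using assms(2) by (intro sum_ennreal) auto
  finally show "measure (pile_space R p) ?A = (\<Sum>r\<in>R. p r * measure (pile_space R p) (B r))"
    using assms(2) by (simp add: S P.emeasure_eq_measure sum_nonneg)
qed

section \<open>Winning probabilities by recursion over the turns\<close>

definition alive :: "nat \<Rightarrow> nat \<Rightarrow> (nat \<Rightarrow> int) \<Rightarrow> bool" where
  "alive M n s \<longleftrightarrow> (\<forall>i\<in>{1..M}. s i < int n)"

definition move :: "nat \<Rightarrow> nat \<Rightarrow> (nat \<Rightarrow> int) \<Rightarrow> int \<Rightarrow> nat \<Rightarrow> int" where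
  "move M t s r = s(mover M t := max 0 (s (mover M t) + r))"

text \<open>
  The game is entered with chips \<open>s\<close> just before turn \<open>t\<close> and is won exactly \<open>l\<close> turns later, at
  turn \<open>t + l\<close>; \<open>\<omega> 0\<close> is the choice at turn \<open>t\<close>.
\<close>

primrec won_after ::
  "nat \<Rightarrow> nat \<Rightarrow> nat \<Rightarrow> nat \<Rightarrow> (nat \<Rightarrow> int) \<Rightarrow> (nat \<Rightarrow> int) \<Rightarrow> bool" where
  "won_after M n 0 t s \<omega> \<longleftrightarrow> alive M n s \<and> move M t s (\<omega> 0) (mover M t) \<ge> int n"
| "won_after M n (Suc l) t s \<omega> \<longleftrightarrow>
     alive M n s \<and> won_after M n l (Suc t) (move M t s (\<omega> 0)) (\<lambda>u. \<omega> (Suc u))"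

text \<open>The recursion of \<open>won_after\<close> with each choice averaged out: it replaces the
  infinite product measure by finite sums that are polynomial in the \<open>p r\<close>.\<close>

primrec won_after_prob ::
  "int set \<Rightarrow> (int \<Rightarrow> real) \<Rightarrow> nat \<Rightarrow> nat \<Rightarrow> nat \<Rightarrow> nat \<Rightarrow> (nat \<Rightarrow> int) \<Rightarrow> real" where
  "won_after_prob R p M n 0 t s =
     (if alive M n s then \<Sum>r\<in>R. p r * of_bool (move M t s r (mover M t) \<ge> int n) else 0)"
| "won_after_prob R p M n (Suc l) t s =
     (if alive M n s then \<Sum>r\<in>R. p r * won_after_prob R p M n l (Suc t) (move M t s r) else 0)"

text \<open>Time shift: \<open>won_after\<close> restarts at an arbitrary turn with a shifted
  sequence, whereas \<open>chips\<close> always runs from turn 0. The induction on \<open>l\<close>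
  moves \<open>t\<close>, hence the general \<open>t\<close>.\<close>

lemma won_after_chips:
  "won_after M n l t (chips M s \<omega> t) (\<lambda>u. \<omega> (t + u)) \<longleftrightarrow>
     (\<forall>u\<in>{t..t + l}. alive M n (chips M s \<omega> u)) \<and>
     chips M s \<omega> (Suc (t + l)) (mover M (t + l)) \<ge> int n"
proof (induction l arbitrary: t)
  case 0
  then show ?case by (simp add: move_def)
next
  case (Suc l)
  have range: "{t..t + Suc l} = insert t {Suc t..Suc t + l}"
    by auto
  have "won_after M n (Suc l) t (chips M s \<omega> t) (\<lambda>u. \<omega> (t + u)) \<longleftrightarrow>
      alive M n (chips M s \<omega> t) \<and>
      won_after M n l (Suc t) (chips M s \<omega> (Suc t)) (\<lambda>u. \<omega> (Suc t + u))"
    by (simp add: move_def)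
  then show ?case
    unfolding Suc.IH range by (simp del: chips.simps(2))
qed

text \<open>The mover at \<open>own_turn M j k\<close> is \<open>j\<close>. The guard
  \<open>k \<ge> 1\<close> matters: by truncated subtraction
  \<open>own_turn M j 0 = own_turn M j 1\<close>.\<close>

lemma wins_at_iff_won_after:
  assumes "j \<in> {1..M}"
  shows "wins_at M n s \<omega> j k \<longleftrightarrow> k \<ge> 1 \<and> won_after M n (own_turn M j k) 0 s \<omega>"
proof (cases "k \<ge> 1")
  case True
  then have "mover M (own_turn M j k) = j"
    using assms own_turn_iff[of j M] by auto
  then show ?thesis
    using True won_after_chips[of M n "own_turn M j k" 0 s \<omega>]
    by (simp add: wins_at_def alive_def del: chips.simps(2))
      (simp add: atLeast0AtMost Ball_def)
qed (auto simp: wins_at_def)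

text \<open>Measurability and value are proved together, since \<open>first_choice\<close> asks for
  measurability of the event that remains after the first choice.\<close>

lemma won_after_prob_correct:
  assumes "finite R" "\<And>r. r \<in> R \<Longrightarrow> p r \<ge> 0" "(\<Sum>r\<in>R. p r) = 1"
  shows "{\<omega> \<in> space (pile_space R p). won_after M n l t s \<omega>} \<in> sets (pile_space R p) \<and>
    measure (pile_space R p) {\<omega> \<in> space (pile_space R p). won_after M n l t s \<omega>}
      = won_after_prob R p M n l t s"
proof -
  let ?P = "pile_space R p"
  interpret P: prob_space ?P
    using assms by (intro prob_space_pile_space)
  have shift: "(\<lambda>u. \<omega> (Suc u)) \<in> space ?P" if "\<omega> \<in> space ?P" for \<omega>
    using that by (auto simp: pile_space_def space_PiM PiE_iff)
  show ?thesis
  proof (induction l arbitrary: t s)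
    case 0
    \<comment> \<open>The first choice alone decides here, so the condition on the tail is
      everything or nothing.\<close>
    define B where "B r = (if move M t s r (mover M t) \<ge> int n then space ?P else {})" for r
    have B: "B r \<in> sets ?P" for r
      by (simp add: B_def)
    have "{\<omega> \<in> space ?P. won_after M n 0 t s \<omega>} =
        (if alive M n s then {\<omega> \<in> space ?P. (\<lambda>u. \<omega> (Suc u)) \<in> B (\<omega> 0)} else {})"
      using shift by (auto simp: B_def)
    moreover have "measure ?P (B r) = of_bool (move M t s r (mover M t) \<ge> int n)" for r
      by (simp add: B_def P.prob_space)
    ultimately show ?case
      using first_choice[where B = B, OF assms B] by simp
  next
    case (Suc l)
    define B where "B r = {\<omega> \<in> space ?P. won_after M n l (Suc t) (move M t s r) \<omega>}" for r
    have B: "B r \<in> sets ?P" for r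
      using Suc.IH by (simp add: B_def)
    have "{\<omega> \<in> space ?P. won_after M n (Suc l) t s \<omega>} =
        (if alive M n s then {\<omega> \<in> space ?P. (\<lambda>u. \<omega> (Suc u)) \<in> B (\<omega> 0)} else {})"
      using shift by (auto simp: B_def)
    moreover have "measure ?P (B r) = won_after_prob R p M n l (Suc t) (move M t s r)" for r
      using Suc.IH by (simp add: B_def)
    ultimately show ?case
      using first_choice[where B = B, OF assms B] by simp
  qed
qed

lemma win_prob_at_eq:
  assumes "finite R" "\<And>r. r \<in> R \<Longrightarrow> p r \<ge> 0" "(\<Sum>r\<in>R. p r) = 1" "j \<in> {1..M}"
  shows "win_prob_at R p M n s j k =
    (if k \<ge> 1 then won_after_prob R p M n (own_turn M j k) 0 s else 0)"
  using won_after_prob_correct[OF assms(1-3)] wins_at_iff_won_after[OF assms(4)]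
  by (simp add: win_prob_at_def)

text \<open>Wins of different players are disjoint events by \<open>wins_at_unique\<close>; this
  reduces losing to winning.\<close>

lemma lose_prob_at_eq:
  assumes "finite R" "\<And>r. r \<in> R \<Longrightarrow> p r \<ge> 0" "(\<Sum>r\<in>R. p r) = 1"
  shows "lose_prob_at R p M n s j k = (\<Sum>i\<in>{1..M} - {j}. win_prob_at R p M n s i k)"
proof -
  let ?P = "pile_space R p"
  interpret P: prob_space ?P
    using assms by (intro prob_space_pile_space)
  have "{\<omega> \<in> space ?P. \<exists>i\<in>{1..M} - {j}. wins_at M n s \<omega> i k} =
      (\<Union>i\<in>{1..M} - {j}. {\<omega> \<in> space ?P. wins_at M n s \<omega> i k})"
    by auto
  moreover have "disjoint_family_on (\<lambda>i. {\<omega> \<in> space ?P. wins_at M n s \<omega> i k}) ({1..M} - {j})"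
    unfolding disjoint_family_on_def using wins_at_unique by blast
  ultimately show ?thesis
    unfolding lose_prob_at_def win_prob_at_def
    using wins_at_sets by (simp add: P.finite_measure_finite_Union image_subset_iff)
qed

section \<open>The linear system\<close>

text \<open>The turn number enters only through \<open>mover\<close>, which has period
  \<open>M\<close>.\<close>

lemma won_after_prob_period: "won_after_prob R p M n l (t + M) s = won_after_prob R p M n l t s"
proof (induction l arbitrary: t s)
  case 0
  then show ?case by (simp add: move_def mover_def)
next
  case (Suc l)
  have "move M (t + M) = move M t"
    by (simp add: move_def mover_def fun_eq_iff)
  then show ?case
    using Suc.IH[of "Suc t"] by simp
qed

text \<open>
  Here round \<open>k\<close> consists of the turns \<open>k * M, \<dots>, k * M + M - 1\<close>, and the game is entered just
  before turn \<open>i\<close>.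
\<close>

definition win_series ::
  "int set \<Rightarrow> (int \<Rightarrow> real) \<Rightarrow> nat \<Rightarrow> nat \<Rightarrow> nat \<Rightarrow> nat \<Rightarrow> (nat \<Rightarrow> int) \<Rightarrow> real fps" where
  "win_series R p M n j i s = Abs_fps (\<lambda>k.
     if i \<le> k * M + (j - 1) then won_after_prob R p M n (k * M + (j - 1) - i) i s else 0)"

text \<open>The factor X is a counting offset: own turns start at 1, rounds at 0.\<close>

lemma win_pgf_eq:
  assumes "finite R" "\<And>r. r \<in> R \<Longrightarrow> p r \<ge> 0" "(\<Sum>r\<in>R. p r) = 1" "j \<in> {1..M}"
  shows "win_pgf R p M n s j = fps_X * win_series R p M n j 0 s"
  by (rule fps_ext)
    (auto simp: win_pgf_def win_series_def win_prob_at_eq[OF assms] own_turn_def Suc_le_eq)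

text \<open>Entering before turn \<open>M\<close> means entering the next round at its start. The
  coefficient at 0 vanishes because \<open>j - 1 < M\<close>.\<close>

lemma win_series_round:
  assumes "j \<in> {1..M}"
  shows "win_series R p M n j M s = fps_X * win_series R p M n j 0 s"
proof (rule fps_ext)
  fix k
  show "win_series R p M n j M s $ k = (fps_X * win_series R p M n j 0 s) $ k"
    using assms won_after_prob_period[of R p M n _ 0 s]
    by (cases k) (auto simp: win_series_def)
qed

text \<open>This closes the system: moves that reach the target leave the finite set of live states,
  but contribute nothing further.\<close>

lemma win_series_not_alive:
  assumes "\<not> alive M n s"
  shows "win_series R p M n j i s = 0"
proof -
  have "won_after_prob R p M n l t s = 0" for l t
    using assms by (cases l) auto
  then show ?thesis
    by (intro fps_ext) (simp add: win_series_def)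
qed

text \<open>Conditioning on the choice at turn \<open>i\<close>. The constant term is a win at turn
  \<open>i\<close> itself, which is a win of \<open>j\<close> only if \<open>i = j - 1\<close>, and
  then in round 0.\<close>

lemma win_series_turn:
  assumes "i < M" "j \<in> {1..M}" "alive M n s"
  shows "win_series R p M n j i s =
    fps_const (if i = j - 1 then won_after_prob R p M n 0 i s else 0) +
    (\<Sum>r\<in>R. fps_const (p r) * win_series R p M n j (Suc i) (move M i s r))"
proof (rule fps_ext)
  fix k
  \<comment> \<open>The turn of \<open>j\<close> in round \<open>k\<close> lies before, at or after
    the entry turn \<open>i\<close>.\<close>
  consider "k * M + (j - 1) < i" | "k * M + (j - 1) = i"
    | l where "k * M + (j - 1) = i + Suc l"
    using less_imp_Suc_add[of i "k * M + (j - 1)"]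
    by (cases "k * M + (j - 1)" i rule: linorder_cases) auto
  then show "win_series R p M n j i s $ k =
    (fps_const (if i = j - 1 then won_after_prob R p M n 0 i s else 0) +
    (\<Sum>r\<in>R. fps_const (p r) * win_series R p M n j (Suc i) (move M i s r))) $ k"
  proof cases
    case 1
    then show ?thesis by (auto simp: win_series_def fps_sum_nth)
  next
    case 2
    then have "k = 0"
      using assms(1) by (cases k) auto
    then show ?thesis
      using 2 assms by (simp add: win_series_def fps_sum_nth)
  next
    case 3
    \<comment> \<open>A later turn of \<open>j\<close> lies in a later round, so the constant term
      does not reach this coefficient.\<close>
    have "k \<noteq> 0" if "i = j - 1"
      using 3 that by (cases k) auto
    then show ?thesis
      using 3 assms by (auto simp: win_series_def fps_sum_nth)
  qed
qed

text \<open>States are functions on all of \<open>nat\<close>. Freezing the coordinates outside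
  \<open>{1..M}\<close>, which no move changes, leaves only finitely many.\<close>

lemma finite_states:
  fixes d :: "nat \<Rightarrow> int"
  shows "finite {s. (\<forall>i\<in>{1..M}. 0 \<le> s i \<and> s i < int n) \<and>
    (\<forall>i. i \<notin> {1..M} \<longrightarrow> s i = d i)}"
  (is "finite ?S")
proof (rule finite_subset)
  show "?S \<subseteq> (\<lambda>f i. if i \<in> {1..M} then f i else d i) ` ({1..M} \<rightarrow>\<^sub>E {0..<int n})"
  proof
    fix s assume "s \<in> ?S"
    then have "s = (\<lambda>i. if i \<in> {1..M} then restrict s {1..M} i else d i)"
      "restrict s {1..M} \<in> {1..M} \<rightarrow>\<^sub>E {0..<int n}"
      by (auto simp: fun_eq_iff)
    then show "s \<in> (\<lambda>f i. if i \<in> {1..M} then f i else d i) ` ({1..M} \<rightarrow>\<^sub>E {0..<int n})"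
      by (rule image_eqI)
  qed
  show "finite ((\<lambda>f i. if i \<in> {1..M} then f i else d i) ` ({1..M} \<rightarrow>\<^sub>E {0..<int n}))"
    by (intro finite_imageI finite_PiE) auto
qed

section \<open>Rationality of the generating functions\<close>

context real_subring
begin

text \<open>One round is traversed backwards from turn \<open>M\<close> to turn 0, each series being
  kept as an affine expression in X times the series at turn 0. At turn 0 itself this is the shape
  required by \<open>rational_fps_over_linear_system\<close>.\<close>

lemma rational_fps_over_win_series:
  assumes "finite R" and p: "\<And>r. r \<in> R \<Longrightarrow> p r \<in> K" and j: "j \<in> {1..M}"
    and s: "\<And>i. i \<in> {1..M} \<Longrightarrow> 0 \<le> s i \<and> s i < int n"
  shows "rational_fps_over K (win_series R p M n j 0 s)"
proof -
  define S where "S = {s'. (\<forall>i\<in>{1..M}. 0 \<le> s' i \<and> s' i < int n) \<and>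
    (\<forall>i. i \<notin> {1..M} \<longrightarrow> s' i = s i)}"
  have "finite S"
    unfolding S_def by (rule finite_states)
  have alive: "alive M n u" if "u \<in> S" for u
    using that by (auto simp: S_def alive_def)
  \<comment> \<open>Only a coordinate in \<open>{1..M}\<close> changes; \<open>max 0\<close> gives
    its lower bound and \<open>alive\<close> the upper one.\<close>
  have move: "move M i u r \<in> S" if "u \<in> S" "i < M" "alive M n (move M i u r)" for i u r
    using that by (auto simp: S_def alive_def move_def mover_def)
  note closed = rational_fps_over_add rational_fps_over_mult rational_fps_over_const
    rational_fps_over_sum
  let ?F = "win_series R p M n j"
  define affine where "affine f \<longleftrightarrow> (\<exists>c q. rational_fps_over K c \<and>
    (\<forall>u. rational_fps_over K (q u)) \<and> f = c + fps_X * (\<Sum>u\<in>S. q u * ?F 0 u))" for f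
  have affineI: "affine (c + fps_X * (\<Sum>u\<in>S. q u * ?F 0 u))"
    if "rational_fps_over K c" "\<And>u. rational_fps_over K (q u)" for c q
    using that by (auto simp: affine_def)
  have affine_const: "affine c" if "rational_fps_over K c" for c
    using affineI[of c "\<lambda>_. 0"] that rational_fps_over_0 by simp
  have affine_add: "affine (f + g)" if "affine f" "affine g" for f g
  proof -
    obtain c q c' q' where "f = c + fps_X * (\<Sum>u\<in>S. q u * ?F 0 u)"
      "g = c' + fps_X * (\<Sum>u\<in>S. q' u * ?F 0 u)"
      and "rational_fps_over K c" "\<And>u. rational_fps_over K (q u)"
        "rational_fps_over K c'" "\<And>u. rational_fps_over K (q' u)"
      using \<open>affine f\<close> \<open>affine g\<close> unfolding affine_def by auto
    then show ?thesis
      using affineI[of "c + c'" "\<lambda>u. q u + q' u"] rational_fps_over_add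
      by (simp add: algebra_simps sum.distrib)
  qed
  have affine_mult: "affine (a * f)" if "rational_fps_over K a" "affine f" for a f
  proof -
    obtain c q where "f = c + fps_X * (\<Sum>u\<in>S. q u * ?F 0 u)"
      and "rational_fps_over K c" "\<And>u. rational_fps_over K (q u)"
      using \<open>affine f\<close> unfolding affine_def by auto
    then show ?thesis
      using affineI[of "a * c" "\<lambda>u. a * q u"] rational_fps_over_mult that(1)
      by (simp add: algebra_simps sum_distrib_left)
  qed
  have affine_sum: "affine (\<Sum>r\<in>A. f r)" if "\<And>r. r \<in> A \<Longrightarrow> affine (f r)"
    for A :: "int set" and f
    using that by (induction A rule: infinite_finite_induct)
      (auto intro: affine_add affine_const rational_fps_over_0)
  have "affine (?F i u)" if "i \<le> M" "u \<in> S" for i u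
    using that
  proof (induction i arbitrary: u rule: inc_induct)
    case base
    \<comment> \<open>The coefficients form the unit vector at \<open>u\<close>.\<close>
    have "?F M u = 0 + fps_X * (\<Sum>u'\<in>S. of_bool (u' = u) * ?F 0 u')"
      using base \<open>finite S\<close> by (simp add: win_series_round[OF j] of_bool_def if_distrib
          if_distribR sum.delta cong: if_cong)
    then show ?case
      using affineI[of 0 "\<lambda>u'. of_bool (u' = u)"] rational_fps_over_0 rational_fps_over_1
      by (simp add: of_bool_def)
  next
    case (step i)
    have "affine (fps_const (if i = j - 1 then won_after_prob R p M n 0 i u else 0))"
      using p by (intro affine_const rational_fps_over_const)
        (auto intro!: sum_mem mult_mem zero_mem one_mem)
    \<comment> \<open>Either the move stays in \<open>S\<close>, where the induction hypothesis
      applies, or the target has been reached and the series is 0.\<close>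
    moreover have "affine (?F (Suc i) (move M i u r))" for r
      using step move win_series_not_alive affine_const[OF rational_fps_over_0]
      by (cases "alive M n (move M i u r)") auto
    then have "affine (\<Sum>r\<in>R. fps_const (p r) * ?F (Suc i) (move M i u r))"
      using p by (intro affine_sum affine_mult rational_fps_over_const)
    ultimately show ?case
      unfolding win_series_turn[OF step.hyps(2) j alive[OF step.prems]]
      by (rule affine_add)
  qed
  then have "affine (?F 0 u)" if "u \<in> S" for u
    using that by simp
  then obtain c q where "\<And>u. u \<in> S \<Longrightarrow> rational_fps_over K (c u)"
    "\<And>u u'. u \<in> S \<Longrightarrow> rational_fps_over K (q u u')"
    "\<And>u. u \<in> S \<Longrightarrow> ?F 0 u = c u + fps_X * (\<Sum>u'\<in>S. q u u' * ?F 0 u')"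
    unfolding affine_def by metis
  then show ?thesis
    using rational_fps_over_linear_system[OF \<open>finite S\<close>, of c q "?F 0" s] s
    by (auto simp: S_def)
qed

lemma rational_fps_over_pgf:
  assumes R: "finite R" "\<And>r. r \<in> R \<Longrightarrow> p r \<ge> 0" "(\<Sum>r\<in>R. p r) = 1"
    and p: "\<And>r. r \<in> R \<Longrightarrow> p r \<in> K"
    and s: "\<And>i. i \<in> {1..M} \<Longrightarrow> 0 \<le> s i \<and> s i < int n"
  shows "j \<in> {1..M} \<Longrightarrow> rational_fps_over K (win_pgf R p M n s j)"
    and "rational_fps_over K (lose_pgf R p M n s j)"
proof -
  show win: "rational_fps_over K (win_pgf R p M n s j)" if "j \<in> {1..M}" for j
    using that s p R by (simp only: win_pgf_eq)
      (intro rational_fps_over_mult rational_fps_over_X rational_fps_over_win_series)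
  have "lose_pgf R p M n s j = (\<Sum>i\<in>{1..M} - {j}. win_pgf R p M n s i)"
    by (rule fps_ext) (simp add: lose_pgf_def win_pgf_def lose_prob_at_eq[OF R] fps_sum_nth)
  then show "rational_fps_over K (lose_pgf R p M n s j)"
    using win by (auto intro!: rational_fps_over_sum)
qed

end

theorem theorem2:
  fixes R :: "int set" and p :: "int \<Rightarrow> real" and M n :: nat
    and s :: "nat \<Rightarrow> int" and j :: nat
  assumes "n \<ge> 1" and "M \<ge> 2"
    and "finite R"
    and "\<And>r. r \<in> R \<Longrightarrow> p r \<ge> 0"
    and "(\<Sum>r\<in>R. p r) = 1"
    and "\<And>i. i \<in> {1..M} \<Longrightarrow> 0 \<le> s i \<and> s i < int n"
    and "j \<in> {1..M}"
  shows "rational_fps (win_pgf R p M n s j) \<and> rational_fps (lose_pgf R p M n s j) \<and>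
    ((\<forall>r\<in>R. p r \<in> \<rat>) \<longrightarrow>
       win_prob R p M n s j \<in> \<rat> \<and> lose_prob R p M n s j \<in> \<rat>)"
proof (intro conjI impI)
  note R = assms(3-5) and s = assms(6) and j = assms(7)
  show "rational_fps (win_pgf R p M n s j)" "rational_fps (lose_pgf R p M n s j)"
    using real_subring_UNIV.rational_fps_over_pgf[OF R _ s] j
    by (simp_all add: rational_fps_over_UNIV)
  assume "\<forall>r\<in>R. p r \<in> \<rat>"
  then have rat: "rational_fps_over \<rat> (win_pgf R p M n s j)"
      "rational_fps_over \<rat> (lose_pgf R p M n s j)"
    using real_subring_Rats.rational_fps_over_pgf[OF R _ s] j by simp_all
  have win_nonneg: "win_prob_at R p M n s j k \<ge> 0" for k
    by (simp add: win_prob_at_def)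
  \<comment> \<open>The terms are nonnegative, so their convergence, as probabilities of disjoint
    events, is absolute.\<close>
  have "summable (\<lambda>k. norm (win_pgf R p M n s j $ k))"
    using win_prob_sums[OF R j, of n s]
    by (simp add: win_pgf_def sums_iff abs_of_nonneg[OF win_nonneg])
  then show "win_prob R p M n s j \<in> \<rat>"
    using rational_fps_over_Rats_suminf[OF rat(1)] by (simp add: win_pgf_def win_prob_def)
  have lose_nonneg: "lose_prob_at R p M n s j k \<ge> 0" for k
    by (simp add: lose_prob_at_def)
  have "summable (\<lambda>k. norm (lose_pgf R p M n s j $ k))"
    using lose_prob_sums[OF R, of M n s j]
    by (simp add: lose_pgf_def sums_iff abs_of_nonneg[OF lose_nonneg])
  then show "lose_prob R p M n s j \<in> \<rat>"
    using rational_fps_over_Rats_suminf[OF rat(2)] by (simp add: lose_pgf_def lose_prob_def)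
qed

end
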